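(* Consider the MAS-SALTD with $n$ agents, local resources $a_1,\dots,a_n$ and utility functions $f_i:\mathbb{R}^{\ge 0}\to\mathbb{R}$, $i=1,\dots,n$. Suppose each $f_i$ is concave over the domain $\mathbb{R}^{\ge 0}$. Then the social welfare equilibrium(s) and the competitive equilibrium(s) coincide. To be precise, the following statements hold. (i) If $(\lambda^\ast,\mathbf{x}^\ast,\mathbf{e}^\ast)$ is a competitive equilibrium, then $(\mathbf{x}^\ast,\mathbf{e}^\ast)$ is a social welfare equilibrium. (ii) If $(\mathbf{x}^\star,\mathbf{e}^\star)$ is a social welfare equilibrium, then there exists $\lambda^\ast\in\mathbb{R}$ such that $(\lambda^\ast,\mathbf{x}^\star,\mathbf{e}^\star)$ is a competitive equilibrium.
   Context: $\mathbb{R}^{\ge 0}=[0,\infty)$. Multi-agent system with static agent load and trading decisions (MAS-SALTD): there are $n$ agents $i=1,\dots,n$; agent $i$ holds $a_i$ units of a local resource ($a_i$ a real number), chooses a load $x_i\in\mathbb{R}^{\ge 0}$ with utility $f_i(x_i)$, $f_i:\mathbb{R}^{\ge 0}\to\mathbb{R}$, and also chooses a traded amount $e_i\in\mathbb{R}$ (positive for selling, negative for buying). Physically, if $x_i<a_i$ agent $i$ can sell, with $0\le e_i\le a_i-x_i$, and if $x_i\ge a_i$ agent $i$ can only buy, with $e_i=a_i-x_i\le 0$; in the equilibrium definitions below the constraint imposed is $x_i+e_i\le a_i$. Each traded unit is priced at $\lambda\in\mathbb{R}$. Write $\mathbf{x}=(x_1,\dots,x_n)^\top$, $\mathbf{e}=(e_1,\dots,e_n)^\top$.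 Competitive equilibrium (MAS-SALTD): a triplet $(\lambda^\ast,\mathbf{x}^\ast,\mathbf{e}^\ast)$ with $\lambda^\ast\in\mathbb{R}$ such that (a) for every $i$, $(x_i^\ast,e_i^\ast)$ is a maximizer of $f_i(x_i)+\lambda^\ast e_i$ over all $(x_i,e_i)\in\mathbb{R}^{\ge 0}\times\mathbb{R}$ with $x_i+e_i\le a_i$; and (b) $\sum_{i=1}^n e_i^\ast=0$. Social welfare equilibrium (MAS-SALTD): a pair $(\mathbf{x}^\star,\mathbf{e}^\star)$ that maximizes $\sum_{i=1}^n f_i(x_i)$ over all $(\mathbf{x},\mathbf{e})$ with $x_i\in\mathbb{R}^{\ge 0}$, $e_i\in\mathbb{R}$, $x_i+e_i\le a_i$ for all $i$, and $\sum_{i=1}^n e_i=0$.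
   Formalization: Part (ii) is stated only when the local resources a_i do not sum to zero, or when each f_i satisfies f_i(y) ≤ f_i(0)+K_i·y for all y ≥ 0 with some real K_i; without this (ii) is false, e.g. all a_i = 0 and f_i(y) = √y. *)

theory Defs
  imports "HOL-Analysis.Analysis"
begin

text \<open>
  The agents are the elements of the finite type \<open>'n\<close>.  A utility function on the half-line
  \<open>[0, \<infinity>)\<close> is a total function on the reals of which only the values on \<open>{0..}\<close> are ever used.
\<close>

definition agent_feasible :: "real \<Rightarrow> real \<times> real \<Rightarrow> bool" where
  "agent_feasible r = (\<lambda>(y, d). 0 \<le> y \<and> y + d \<le> r)"

definition agent_payoff :: "(real \<Rightarrow> real) \<Rightarrow> real \<Rightarrow> real \<times> real \<Rightarrow> real" where
  "agent_payoff u l = (\<lambda>(y, d). u y + l * d)"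

definition competitive_equilibrium ::
  "('n::finite \<Rightarrow> real \<Rightarrow> real) \<Rightarrow> real ^ 'n \<Rightarrow> real \<Rightarrow> real ^ 'n \<Rightarrow> real ^ 'n \<Rightarrow> bool" where
  "competitive_equilibrium f a l x e \<longleftrightarrow>
     (\<forall>i. is_arg_max (agent_payoff (f i) l) (agent_feasible (a $ i)) (x $ i, e $ i)) \<and>
     (\<Sum>i\<in>UNIV. e $ i) = 0"

definition social_feasible :: "real ^ 'n::finite \<Rightarrow> (real ^ 'n) \<times> (real ^ 'n) \<Rightarrow> bool" where
  "social_feasible a = (\<lambda>(x, e).
     (\<forall>i. 0 \<le> x $ i \<and> x $ i + e $ i \<le> a $ i) \<and> (\<Sum>i\<in>UNIV. e $ i) = 0)"

definition social_welfare ::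
  "('n::finite \<Rightarrow> real \<Rightarrow> real) \<Rightarrow> (real ^ 'n) \<times> (real ^ 'n) \<Rightarrow> real" where
  "social_welfare f = (\<lambda>(x, e). \<Sum>i\<in>UNIV. f i (x $ i))"

definition social_welfare_equilibrium ::
  "('n::finite \<Rightarrow> real \<Rightarrow> real) \<Rightarrow> real ^ 'n \<Rightarrow> real ^ 'n \<Rightarrow> real ^ 'n \<Rightarrow> bool" where
  "social_welfare_equilibrium f a x e \<longleftrightarrow>
     is_arg_max (social_welfare f) (social_feasible a) (x, e)"

text \<open>
  Concavity on \<open>[0, \<infinity>)\<close> alone does not yield an equilibrium price when the total resource is zero:
  then every load is forced to zero, and a utility of infinite slope at zero admits no supporting
  price.  The following example shows this for every number of agents.  It is the reason why the
  existence of a price requires either a nonzero total resource or, for every agent, a bound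
  \<open>f i y \<le> f i 0 + K * y\<close> on the slope at zero.
\<close>

lemma concave_on_sqrt: "concave_on {0..} sqrt"
proof -
  have ineq: "(1 - t) * sqrt x + t * sqrt y \<le> sqrt ((1 - t) * x + t * y)"
    if "0 < t" "t < 1" "0 \<le> x" "0 \<le> y" for t x y :: real
  proof (rule real_le_rsqrt)
    define u v where "u = sqrt x" and "v = sqrt y"
    have xy: "x = u\<^sup>2" "y = v\<^sup>2" using that by (auto simp: u_def v_def)
    have "0 \<le> t * (1 - t) * (u - v)\<^sup>2" using that by simp
    also have "\<dots> = (1 - t) * u\<^sup>2 + t * v\<^sup>2 - ((1 - t) * u + t * v)\<^sup>2"
      by (simp add: power2_eq_square algebra_simps)
    finally show "((1 - t) * sqrt x + t * sqrt y)\<^sup>2 \<le> (1 - t) * x + t * y"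
      unfolding u_def[symmetric] v_def[symmetric] unfolding xy by simp
  qed
  show ?thesis
    unfolding concave_on_def
  proof (rule convex_onI)
    fix t x y :: real
    assume "0 < t" "t < 1" "x \<in> {0..}" "y \<in> {0..}"
    then show "- sqrt ((1 - t) *\<^sub>R x + t *\<^sub>R y) \<le> (1 - t) * - sqrt x + t * - sqrt y"
      using ineq[of t x y] by simp
  qed simp
qed

lemma no_price_if_no_resource:
  fixes f :: "'n::finite \<Rightarrow> real \<Rightarrow> real"
  assumes f: "f = (\<lambda>i. sqrt)"
  shows "\<forall>i. concave_on {0..} (f i)"
    and "social_welfare_equilibrium f 0 0 0"
    and "\<not> (\<exists>l. competitive_equilibrium f 0 l 0 0)"
proof -
  show "\<forall>i. concave_on {0..} (f i)" using f concave_on_sqrt by simp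
  have x0: "x $ i = 0" if "social_feasible 0 (x, e)" for x e :: "real ^ 'n" and i
  proof -
    have h: "\<And>i. 0 \<le> x $ i" "\<And>i. x $ i + e $ i \<le> 0" "(\<Sum>i\<in>UNIV. e $ i) = 0"
      using that by (auto simp: social_feasible_def)
    have "(\<Sum>i\<in>UNIV. x $ i) + (\<Sum>i\<in>UNIV. e $ i) \<le> 0"
      unfolding sum.distrib[symmetric] by (rule sum_nonpos) (use h in auto)
    then have "(\<Sum>i\<in>UNIV. x $ i) = 0"
      using h by (simp add: order_antisym sum_nonneg)
    then show ?thesis using h(1) by (simp add: sum_nonneg_eq_0_iff)
  qed
  show "social_welfare_equilibrium f 0 0 0"
    unfolding social_welfare_equilibrium_def is_arg_max_def
  proof (intro conjI notI)
    show "social_feasible 0 (0, 0 :: real ^ 'n)" by (simp add: social_feasible_def)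
  next
    assume "\<exists>p. social_feasible 0 p \<and> social_welfare f (0, 0) < social_welfare f p"
    then obtain x e where "social_feasible 0 (x, e)"
        and less: "social_welfare f (0, 0) < social_welfare f (x, e)"
      by auto
    then have "\<And>i. x $ i = 0" using x0 by blast
    then show False using less by (simp add: social_welfare_def f)
  qed
  show "\<not> (\<exists>l. competitive_equilibrium f 0 l 0 0)"
  proof
    assume "\<exists>l. competitive_equilibrium f 0 l 0 0"
    then obtain l where l: "competitive_equilibrium f 0 l 0 0" ..
    define k where "k = \<bar>l\<bar> + 1"
    have k: "k > 0" "l < k" by (auto simp: k_def)
    have "agent_feasible 0 (1 / k\<^sup>2, - (1 / k\<^sup>2))" by (simp add: agent_feasible_def)
    moreover have "is_arg_max (agent_payoff sqrt l) (agent_feasible 0) (0, 0)"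
      using l by (simp add: competitive_equilibrium_def f)
    ultimately have "agent_payoff sqrt l (1 / k\<^sup>2, - (1 / k\<^sup>2)) \<le> agent_payoff sqrt l (0, 0)"
      unfolding is_arg_max_def using not_less by blast
    then have "sqrt (1 / k\<^sup>2) - l * (1 / k\<^sup>2) \<le> 0"
      by (simp add: agent_payoff_def)
    then have "1 / k \<le> l / k\<^sup>2" using k by (simp add: real_sqrt_divide)
    then have "k \<le> l" using k by (simp add: field_simps power2_eq_square)
    then show False using k by simp
  qed
qed

end

theory Submission
  imports Defs
begin

text \<open>
  The price is a Lagrange multiplier \<open>l \<ge> 0\<close> of the single constraint \<open>\<Sum> x \<le> \<Sum> a\<close>, to which the
  social welfare problem reduces once the trades are eliminated.  If the total resource is positive,
  zero load is a Slater point and \<open>l\<close> comes from a line separating the hypograph of the value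
  function from the optimal point; if it is zero, all loads vanish and any common upper bound of the
  slopes at zero serves as \<open>l\<close>.  Complementary slackness makes \<open>l * e $ i = l * (a $ i - x $ i)\<close> hold
  agent by agent, so the Lagrangian splits into the individual payoffs.
\<close>

text \<open>Adding up the agents' optimality inequalities at the common price suffices: the payments
  cancel in the sum, because the trades balance on both sides.\<close>

lemma competitive_equilibrium_imp_social_welfare_equilibrium:
  assumes "competitive_equilibrium f a l x e"
  shows "social_welfare_equilibrium f a x e"
proof -
  have feas: "agent_feasible (a $ i) (x $ i, e $ i)"
    and opt: "agent_feasible (a $ i) p \<Longrightarrow>
      agent_payoff (f i) l p \<le> agent_payoff (f i) l (x $ i, e $ i)" for i p
    using assms by (cases p; auto simp: competitive_equilibrium_def is_arg_max_def not_less)+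
  have e0: "(\<Sum>i\<in>UNIV. e $ i) = 0"
    using assms by (simp add: competitive_equilibrium_def)
  have "social_welfare f (y, d) \<le> social_welfare f (x, e)"
    if yd: "social_feasible a (y, d)" for y d
  proof -
    have "(\<Sum>i\<in>UNIV. f i (y $ i) + l * d $ i) \<le> (\<Sum>i\<in>UNIV. f i (x $ i) + l * e $ i)"
    proof (rule sum_mono)
      fix i
      show "f i (y $ i) + l * d $ i \<le> f i (x $ i) + l * e $ i"
        using opt[of i "(y $ i, d $ i)"] yd
        by (simp add: agent_feasible_def agent_payoff_def social_feasible_def)
    qed
    then show ?thesis
      using yd e0
      by (simp add: social_welfare_def social_feasible_def sum.distrib flip: sum_distrib_left)
  qed
  moreover have "social_feasible a (x, e)"
    using feas e0 by (simp add: social_feasible_def agent_feasible_def)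
  ultimately show ?thesis
    by (auto simp: social_welfare_equilibrium_def is_arg_max_def not_less)
qed

lemma social_feasible_sum_le:
  assumes "social_feasible a (x, e)"
  shows "(\<Sum>i\<in>UNIV. x $ i) \<le> (\<Sum>i\<in>UNIV. a $ i)"
proof -
  have "(\<Sum>i\<in>UNIV. x $ i + e $ i) \<le> (\<Sum>i\<in>UNIV. a $ i)"
    using assms by (intro sum_mono) (simp add: social_feasible_def)
  then show ?thesis
    using assms by (simp add: social_feasible_def sum.distrib)
qed

text \<open>This eliminates the trades: loads that respect only the aggregate bound can always be
  completed by balanced trades.\<close>

lemma social_welfare_equilibrium_bound:
  fixes a :: "real ^ 'n::finite"
  assumes "social_welfare_equilibrium f a x e"
    and "\<And>i. 0 \<le> y $ i" and "(\<Sum>i\<in>UNIV. y $ i) \<le> (\<Sum>i\<in>UNIV. a $ i)"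
  shows "(\<Sum>i\<in>UNIV. f i (y $ i)) \<le> (\<Sum>i\<in>UNIV. f i (x $ i))"
proof -
  define c where "c = ((\<Sum>i\<in>UNIV. a $ i) - (\<Sum>i\<in>UNIV. y $ i)) / real CARD('n)"
  define d :: "real ^ 'n" where "d = (\<chi> i. a $ i - y $ i - c)"
  have "c \<ge> 0"
    using assms(3) by (simp add: c_def)
  moreover have "(\<Sum>i\<in>UNIV. d $ i) = 0"
    by (simp add: d_def sum_subtractf c_def)
  ultimately have "social_feasible a (y, d)"
    using assms(2) by (simp add: social_feasible_def d_def)
  then show ?thesis
    using assms(1)
    by (fastforce simp: social_welfare_equilibrium_def is_arg_max_def social_welfare_def not_less)
qed

lemma competitive_equilibrium_of_multiplier:
  fixes a :: "real ^ 'n::finite"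
  assumes feas: "social_feasible a (x, e)" and "0 \<le> l"
    and lagrange: "\<And>y :: real ^ 'n. (\<And>i. 0 \<le> y $ i) \<Longrightarrow>
      (\<Sum>i\<in>UNIV. f i (y $ i)) + l * ((\<Sum>i\<in>UNIV. a $ i) - (\<Sum>i\<in>UNIV. y $ i))
        \<le> (\<Sum>i\<in>UNIV. f i (x $ i))"
  shows "competitive_equilibrium f a l x e"
proof -
  have x0: "0 \<le> x $ i" and xe: "x $ i + e $ i \<le> a $ i" for i
    using feas by (simp_all add: social_feasible_def)
  have e0: "(\<Sum>i\<in>UNIV. e $ i) = 0"
    using feas by (simp add: social_feasible_def)
  \<comment> \<open>At \<open>x\<close> itself, \<open>lagrange\<close> bounds this product above by
    0, while both factors are nonnegative.\<close>
  have slack: "l * ((\<Sum>i\<in>UNIV. a $ i) - (\<Sum>i\<in>UNIV. x $ i)) = 0"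
    using lagrange[of x] x0 social_feasible_sum_le[OF feas] \<open>0 \<le> l\<close>
    by (metis (no_types, lifting) add_le_same_cancel1 antisym diff_ge_0_iff_ge mult_nonneg_nonneg)
  \<comment> \<open>Aggregate slackness becomes slackness of each agent, since nonnegative terms
    with sum zero all vanish.\<close>
  have "(\<Sum>i\<in>UNIV. l * (a $ i - x $ i - e $ i)) = 0"
    using slack e0 by (simp add: sum_subtractf flip: sum_distrib_left)
  moreover have "0 \<le> l * (a $ i - x $ i - e $ i)" for i
    using \<open>0 \<le> l\<close> xe[of i] by simp
  ultimately have "l * (a $ i - x $ i - e $ i) = 0" for i
    by (auto simp: sum_nonneg_eq_0_iff)
  then have le: "l * e $ i = l * (a $ i - x $ i)" for i
    by (simp add: right_diff_distrib)
  have "is_arg_max (agent_payoff (f i) l) (agent_feasible (a $ i)) (x $ i, e $ i)" for i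
  proof -
    have "agent_payoff (f i) l (z, d) \<le> agent_payoff (f i) l (x $ i, e $ i)"
      if zd: "agent_feasible (a $ i) (z, d)" for z d
    proof -
      have z: "0 \<le> z" "d \<le> a $ i - z"
        using zd by (auto simp: agent_feasible_def)
      \<comment> \<open>Let agent \<open>i\<close> alone deviate; all other terms of the Lagrangian
        cancel.\<close>
      define y :: "real ^ 'n" where "y = (\<chi> j. if j = i then z else x $ j)"
      have upd: "(\<Sum>j\<in>UNIV. g j (y $ j)) = (\<Sum>j\<in>UNIV. g j (x $ j)) - g i (x $ i) + g i z"
        for g :: "'n \<Rightarrow> real \<Rightarrow> real"
        by (simp add: sum.remove[of UNIV i] y_def)
      have "(\<Sum>j\<in>UNIV. f j (y $ j)) + l * ((\<Sum>j\<in>UNIV. a $ j) - (\<Sum>j\<in>UNIV. y $ j))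
          \<le> (\<Sum>j\<in>UNIV. f j (x $ j))"
        using x0 z by (intro lagrange) (simp add: y_def)
      then have "f i z - l * z \<le> f i (x $ i) - l * x $ i"
        using slack unfolding upd[of f] upd[of "\<lambda>_ t. t"] right_diff_distrib distrib_left
        by linarith
      \<comment> \<open>At a nonnegative price, selling all that the load \<open>z\<close> leaves
        over is a best trade.\<close>
      moreover have "l * d \<le> l * (a $ i - z)"
        using z \<open>0 \<le> l\<close> by (intro mult_left_mono)
      ultimately show ?thesis
        using le[of i] by (simp add: agent_payoff_def algebra_simps)
    qed
    then show ?thesis
      using x0 xe by (auto simp: is_arg_max_def agent_feasible_def not_less)
  qed
  then show ?thesis
    using e0 by (simp add: competitive_equilibrium_def)
qed

text \<open>Mixing the witnessing loads proves convexity. Quantifying over loads avoids a supremum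
  that might be infinite or unattained; the strict inequality in \<open>t\<close> keeps the optimal
  point outside the set.\<close>

lemma convex_strict_hypograph_value_function:
  fixes f :: "'n::finite \<Rightarrow> real \<Rightarrow> real"
  assumes conc: "\<And>i. concave_on {0..} (f i)"
  shows "convex {(s, t). \<exists>y :: real ^ 'n. (\<forall>i. 0 \<le> y $ i) \<and> (\<Sum>i\<in>UNIV. y $ i) \<le> s \<and>
    t < (\<Sum>i\<in>UNIV. f i (y $ i))}" (is "convex ?S")
proof (rule convexI)
  fix p q and u v :: real
  assume pq: "p \<in> ?S" "q \<in> ?S" and uv: "0 \<le> u" "0 \<le> v" "u + v = 1"
  obtain s t s' t' where eq: "p = (s, t)" "q = (s', t')"
    by (cases p, cases q)
  obtain y y' :: "real ^ 'n" where y: "\<And>i. 0 \<le> y $ i" "(\<Sum>i\<in>UNIV. y $ i) \<le> s"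
      "t < (\<Sum>i\<in>UNIV. f i (y $ i))"
    and y': "\<And>i. 0 \<le> y' $ i" "(\<Sum>i\<in>UNIV. y' $ i) \<le> s'" "t' < (\<Sum>i\<in>UNIV. f i (y' $ i))"
    using pq by (auto simp: eq)
  define z where "z = u *\<^sub>R y + v *\<^sub>R y'"
  have "\<forall>i. 0 \<le> z $ i"
    using y y' uv by (simp add: z_def)
  moreover have "(\<Sum>i\<in>UNIV. z $ i) \<le> u * s + v * s'"
    using y y' uv
    by (simp add: z_def sum.distrib add_mono mult_left_mono flip: sum_distrib_left)
  moreover have "u * t + v * t' < (\<Sum>i\<in>UNIV. f i (z $ i))"
  proof -
    have "u * t + v * t' < u * (\<Sum>i\<in>UNIV. f i (y $ i)) + v * (\<Sum>i\<in>UNIV. f i (y' $ i))"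
    \<comment> \<open>Strictness comes from \<open>y\<close> if its weight is positive, and
      otherwise from \<open>y'\<close>, whose weight is then 1.\<close>
    proof (cases "u = 0")
      case False
      then show ?thesis
        using y y' uv by (intro add_less_le_mono mult_strict_left_mono mult_left_mono) auto
    qed (use y' uv in simp)
    also have "\<dots> = (\<Sum>i\<in>UNIV. u * f i (y $ i) + v * f i (y' $ i))"
      by (simp add: sum.distrib sum_distrib_left)
    also have "\<dots> \<le> (\<Sum>i\<in>UNIV. f i (z $ i))"
    proof (rule sum_mono)
      fix i
      show "u * f i (y $ i) + v * f i (y' $ i) \<le> f i (z $ i)"
        using conc[of i] y(1)[of i] y'(1)[of i] uv by (simp add: concave_on_iff z_def)
    qed
    finally show ?thesis .
  qed
  ultimately show "u *\<^sub>R p + v *\<^sub>R q \<in> ?S"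
    by (auto simp: eq)
qed

lemma multiplier_exists:
  fixes f :: "'n::finite \<Rightarrow> real \<Rightarrow> real"
  assumes conc: "\<And>i. concave_on {0..} (f i)" and "0 < A"
    and opt: "\<And>y :: real ^ 'n. (\<And>i. 0 \<le> y $ i) \<Longrightarrow> (\<Sum>i\<in>UNIV. y $ i) \<le> A \<Longrightarrow>
      (\<Sum>i\<in>UNIV. f i (y $ i)) \<le> F"
  obtains l where "0 \<le> l"
    and "\<And>y :: real ^ 'n. (\<And>i. 0 \<le> y $ i) \<Longrightarrow>
      (\<Sum>i\<in>UNIV. f i (y $ i)) + l * (A - (\<Sum>i\<in>UNIV. y $ i)) \<le> F"
proof -
  define S where "S = {(s, t). \<exists>y :: real ^ 'n. (\<forall>i. 0 \<le> y $ i) \<and> (\<Sum>i\<in>UNIV. y $ i) \<le> s \<and>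
    t < (\<Sum>i\<in>UNIV. f i (y $ i))}"
  define G where "G = (\<Sum>i\<in>UNIV. f i 0)"
  have zero: "(s, t) \<in> S" if "0 \<le> s" "t < G" for s t
    unfolding S_def using that by (auto simp: G_def intro!: exI[of _ 0])
  have "convex S"
    unfolding S_def by (rule convex_strict_hypograph_value_function[OF conc])
  moreover have "S \<noteq> {}"
    using zero[of 0 "G - 1"] by auto
  moreover have "S \<inter> {(A, F)} = {}"
    using opt by (fastforce simp: S_def)
  ultimately obtain n b where n: "n \<noteq> 0" "\<forall>z\<in>S. n \<bullet> z \<le> b" "\<forall>z\<in>{(A, F)}. b \<le> n \<bullet> z"
    using separating_hyperplane_sets[of S "{(A, F)}"] by auto
  obtain p q where pq: "n = (p, q)"
    by (cases n)
  have sep: "p * s + q * t \<le> p * A + q * F" if "(s, t) \<in> S" for s t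
    using n(2) n(3) that by (force simp: pq)
  \<comment> \<open>\<open>S\<close> contains points with arbitrarily large \<open>s\<close>, so a
    positive \<open>p\<close> would break the bound \<open>sep\<close>.\<close>
  have p: "p \<le> 0"
  proof (rule ccontr)
    assume "\<not> p \<le> 0"
    then have "p > 0" by simp
    define s where "s = (\<bar>p * A + q * F - q * (G - 1)\<bar> + 1) / p"
    have "p * s + q * (G - 1) \<le> p * A + q * F"
      using \<open>p > 0\<close> by (intro sep zero) (auto simp: s_def)
    moreover have "p * s = \<bar>p * A + q * F - q * (G - 1)\<bar> + 1"
      using \<open>p > 0\<close> by (simp add: s_def)
    ultimately show False by linarith
  qed
  \<comment> \<open>Likewise \<open>S\<close> is unbounded below in \<open>t\<close>; the minimum
    defining \<open>t\<close> also keeps it under \<open>G\<close>.\<close>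
  have q: "q \<ge> 0"
  proof (rule ccontr)
    assume "\<not> q \<ge> 0"
    then have "q < 0" by simp
    define t where "t = min (G - 1) ((\<bar>p * A + q * F\<bar> + 1) / q)"
    have "p * 0 + q * t \<le> p * A + q * F"
      by (intro sep zero) (auto simp: t_def)
    moreover have "q * ((\<bar>p * A + q * F\<bar> + 1) / q) \<le> q * t"
      using \<open>q < 0\<close> by (intro mult_left_mono_neg) (auto simp: t_def)
    moreover have "q * ((\<bar>p * A + q * F\<bar> + 1) / q) = \<bar>p * A + q * F\<bar> + 1"
      using \<open>q < 0\<close> by simp
    ultimately show False by linarith
  qed
  \<comment> \<open>The Slater point rules out a vertical line: zero load would give
    \<open>0 \<le> p * A\<close> with \<open>p < 0 < A\<close>.\<close>
  have "q \<noteq> 0"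
  proof
    assume "q = 0"
    then have "p < 0"
      using p n(1) pq by (auto simp: zero_prod_def)
    moreover have "0 \<le> p * A"
      using sep[OF zero[of 0 "G - 1"]] \<open>q = 0\<close> by simp
    ultimately show False
      using \<open>0 < A\<close> by (simp add: zero_le_mult_iff)
  qed
  with q have "q > 0" by simp
  \<comment> \<open>The slope of the separating line, which supports the value function at
    \<open>A\<close>.\<close>
  define l where "l = - p / q"
  have "0 \<le> l"
    using p \<open>q > 0\<close> by (simp add: l_def divide_nonpos_pos)
  have p_eq: "p = - (q * l)"
    using \<open>q > 0\<close> by (simp add: l_def)
  have "(\<Sum>i\<in>UNIV. f i (y $ i)) + l * (A - (\<Sum>i\<in>UNIV. y $ i)) \<le> F"
    if y: "\<And>i. 0 \<le> y $ i" for y :: "real ^ 'n"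
  proof -
    \<comment> \<open>Only points strictly below the welfare of \<open>y\<close> lie in
      \<open>S\<close>; density of the reals recovers the welfare itself.\<close>
    have "t \<le> F - l * (A - (\<Sum>i\<in>UNIV. y $ i))" if t: "t < (\<Sum>i\<in>UNIV. f i (y $ i))" for t
    proof -
      have "((\<Sum>i\<in>UNIV. y $ i), t) \<in> S"
        using y t by (auto simp: S_def)
      from sep[OF this] have "q * t \<le> q * (F - l * (A - (\<Sum>i\<in>UNIV. y $ i)))"
        unfolding p_eq by (simp add: algebra_simps)
      then show ?thesis
        using \<open>q > 0\<close> by simp
    qed
    then have "(\<Sum>i\<in>UNIV. f i (y $ i)) \<le> F - l * (A - (\<Sum>i\<in>UNIV. y $ i))"
      by (rule dense_le)
    then show ?thesis by simp
  qed
  with \<open>0 \<le> l\<close> show ?thesis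
    by (rule that)
qed

lemma multiplier_exists_no_resource:
  fixes f :: "'n::finite \<Rightarrow> real \<Rightarrow> real"
  assumes "\<forall>i. \<exists>K. \<forall>y\<ge>0. f i y \<le> f i 0 + K * y"
  obtains l where "0 \<le> l"
    and "\<And>y :: real ^ 'n. (\<And>i. 0 \<le> y $ i) \<Longrightarrow>
      (\<Sum>i\<in>UNIV. f i (y $ i)) + l * (0 - (\<Sum>i\<in>UNIV. y $ i)) \<le> (\<Sum>i\<in>UNIV. f i 0)"
proof -
  obtain K where K: "\<And>i y. 0 \<le> y \<Longrightarrow> f i y \<le> f i 0 + K i * y"
    using assms by metis
  \<comment> \<open>The sum of absolute values is nonnegative and dominates every
    \<open>K i\<close>.\<close>
  define l where "l = (\<Sum>i\<in>UNIV. \<bar>K i\<bar>)"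
  have "0 \<le> l"
    by (simp add: l_def sum_nonneg)
  have Kl: "K i \<le> l" for i
    using member_le_sum[of i UNIV "\<lambda>i. \<bar>K i\<bar>"] by (simp add: l_def)
  have "(\<Sum>i\<in>UNIV. f i (y $ i)) + l * (0 - (\<Sum>i\<in>UNIV. y $ i)) \<le> (\<Sum>i\<in>UNIV. f i 0)"
    if y: "\<And>i. 0 \<le> y $ i" for y :: "real ^ 'n"
  proof -
    have "(\<Sum>i\<in>UNIV. f i (y $ i)) \<le> (\<Sum>i\<in>UNIV. f i 0 + l * y $ i)"
    proof (rule sum_mono)
      fix i
      show "f i (y $ i) \<le> f i 0 + l * y $ i"
        using K[OF y, of i i] mult_right_mono[OF Kl[of i] y[of i]] by linarith
    qed
    then show ?thesis
      by (simp add: sum.distrib flip: sum_distrib_left)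
  qed
  with \<open>0 \<le> l\<close> show ?thesis
    by (rule that)
qed

lemma social_welfare_equilibrium_imp_competitive_equilibrium:
  fixes f :: "'n::finite \<Rightarrow> real \<Rightarrow> real" and a :: "real ^ 'n"
  assumes conc: "\<And>i. concave_on {0..} (f i)"
    and nondegenerate:
      "(\<Sum>i\<in>UNIV. a $ i) \<noteq> 0 \<or> (\<forall>i. \<exists>K. \<forall>y\<ge>0. f i y \<le> f i 0 + K * y)"
    and swe: "social_welfare_equilibrium f a x e"
  shows "\<exists>l. competitive_equilibrium f a l x e"
proof -
  have feas: "social_feasible a (x, e)"
    using swe by (simp add: social_welfare_equilibrium_def is_arg_max_def)
  then have x0: "0 \<le> x $ i" for i
    by (simp add: social_feasible_def)
  have sum_x: "0 \<le> (\<Sum>i\<in>UNIV. x $ i)" "(\<Sum>i\<in>UNIV. x $ i) \<le> (\<Sum>i\<in>UNIV. a $ i)"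
    using x0 social_feasible_sum_le[OF feas] by (auto intro: sum_nonneg)
  show ?thesis
  proof (cases "(\<Sum>i\<in>UNIV. a $ i) = 0")
    case True
    then have "(\<Sum>i\<in>UNIV. x $ i) = 0"
      using sum_x by simp
    then have x_eq: "x $ i = 0" for i
      using x0 by (simp add: sum_nonneg_eq_0_iff)
    have "\<forall>i. \<exists>K. \<forall>y\<ge>0. f i y \<le> f i 0 + K * y"
      using nondegenerate True by blast
    then obtain l where "0 \<le> l"
      and "\<And>y :: real ^ 'n. (\<And>i. 0 \<le> y $ i) \<Longrightarrow>
        (\<Sum>i\<in>UNIV. f i (y $ i)) + l * (0 - (\<Sum>i\<in>UNIV. y $ i)) \<le> (\<Sum>i\<in>UNIV. f i 0)"
      using multiplier_exists_no_resource[of f] by blast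
    with x_eq True show ?thesis
      by (intro exI[of _ l] competitive_equilibrium_of_multiplier[OF feas]) simp_all
  next
    case False
    \<comment> \<open>Feasibility already forces a nonnegative total, so a nonzero one leaves room
      for the Slater point.\<close>
    then have "0 < (\<Sum>i\<in>UNIV. a $ i)"
      using sum_x by simp
    then obtain l where "0 \<le> l"
      and "\<And>y :: real ^ 'n. (\<And>i. 0 \<le> y $ i) \<Longrightarrow>
        (\<Sum>i\<in>UNIV. f i (y $ i)) + l * ((\<Sum>i\<in>UNIV. a $ i) - (\<Sum>i\<in>UNIV. y $ i))
          \<le> (\<Sum>i\<in>UNIV. f i (x $ i))"
      using multiplier_exists[OF conc _ social_welfare_equilibrium_bound[OF swe]] by blast
    then show ?thesis
      using competitive_equilibrium_of_multiplier[OF feas] by blast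
  qed
qed

theorem theorem2:
  fixes f :: "'n::finite \<Rightarrow> real \<Rightarrow> real" and a :: "real ^ 'n"
  assumes "\<forall>i. concave_on {0..} (f i)"
  shows "(\<forall>l x e. competitive_equilibrium f a l x e \<longrightarrow> social_welfare_equilibrium f a x e) \<and>
    ((\<Sum>i\<in>UNIV. a $ i) \<noteq> 0 \<or> (\<forall>i. \<exists>K. \<forall>y\<ge>0. f i y \<le> f i 0 + K * y) \<longrightarrow>
      (\<forall>x e. social_welfare_equilibrium f a x e \<longrightarrow> (\<exists>l. competitive_equilibrium f a l x e)))"
  using assms competitive_equilibrium_imp_social_welfare_equilibrium
    social_welfare_equilibrium_imp_competitive_equilibrium by blast

end
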